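(* For a regular $P$-space $X$ the following properties are equivalent: (1) $X$ is Lindelöf; (2) $X$ is Menger; (3) $X$ is Scheepers; (4) $X$ is almost Lindelöf; (5) $X$ is almost Menger; (6) $X$ is almost Scheepers; (7) $X$ is almost Alster; (8) $X$ is weakly Lindelöf; (9) $X$ is weakly Menger; (10) $X$ is weakly Scheepers (in the sense of Sakai); (11) $X$ is weakly Alster; (12) $X$ is weakly Scheepers in the sense of Kočinac.
   Context: A $P$-space is a topological space in which every $G_\delta$ set is open. Lindelöf means that every open cover has a countable subcover. $X$ is almost Lindelöf (respectively, weakly Lindelöf) if every open cover $\mathcal{U}$ of $X$ has a countable subset $\mathcal{V}$ such that $\{\overline{V}:V\in\mathcal{V}\}$ covers $X$ (respectively, $\bigcup\mathcal{V}$ is dense in $X$). $X$ is Menger (respectively, almost Menger, weakly Menger) if for every sequence $(\mathcal{U}_n)_{n\in\mathbb{N}}$ of open covers of $X$ there are finite $\mathcal{V}_n\subseteq\mathcal{U}_n$ such that $\bigcup_n\mathcal{V}_n$ covers $X$ (respectively, $\{\overline{V}:V\in\bigcup_n\mathcal{V}_n\}$ covers $X$, $\bigcup\left(\bigcup_n\mathcal{V}_n\right)$ is dense in $X$). $X$ is Scheepers (respectively, almost Scheepers) if for every sequence $(\mathcal{U}_n)$ of open covers of $X$ there are finite $\mathcal{V}_n\subseteq\mathcal{U}_n$ such that every finite $F\subseteq X$ is contained in $\bigcup\mathcal{V}_n$ (respectively, in $\overline{\bigcup\mathcal{V}_n}$) for some $n$. $X$ is weakly Scheepers (in the sense of Sakai)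 if for every sequence $(\mathcal{U}_n)$ of open covers of $X$ there are finite $\mathcal{V}_n\subseteq\mathcal{U}_n$ such that for every finite collection $\mathcal{F}$ of nonempty open subsets of $X$ there is an $n$ with $U\cap\left(\bigcup\mathcal{V}_n\right)\neq\emptyset$ for all $U\in\mathcal{F}$. $X$ is weakly Scheepers in the sense of Kočinac if for every sequence $(\mathcal{U}_n)$ of open covers of $X$ there are a dense set $Y\subseteq X$ and finite $\mathcal{V}_n\subseteq\mathcal{U}_n$ such that every finite $F\subseteq Y$ is contained in $\bigcup\mathcal{V}_n$ for some $n$. Let $\mathcal{G}_K$ be the class of all families $\mathcal{U}$ of $G_\delta$ subsets of $X$ such that $X\notin\mathcal{U}$ and every compact $C\subseteq X$ is contained in some $U\in\mathcal{U}$. $X$ is almost Alster (respectively, weakly Alster) if each $\mathcal{U}\in\mathcal{G}_K$ has a countable subset $\mathcal{V}$ such that $\{\overline{V}:V\in\mathcal{V}\}$ covers $X$ (respectively, $\bigcup\mathcal{V}$ is dense in $X$). *)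

theory Defs
  imports "HOL-Analysis.Analysis"
begin

definition P_space :: "'a topology \<Rightarrow> bool" where
  "P_space X \<longleftrightarrow> (\<forall>S. gdelta_in X S \<longrightarrow> openin X S)"

definition open_cover :: "'a topology \<Rightarrow> 'a set set \<Rightarrow> bool" where
  "open_cover X \<U> \<longleftrightarrow> (\<forall>U\<in>\<U>. openin X U) \<and> \<Union>\<U> = topspace X"

definition dense_in :: "'a topology \<Rightarrow> 'a set \<Rightarrow> bool" where
  "dense_in X S \<longleftrightarrow> S \<subseteq> topspace X \<and> X closure_of S = topspace X"

definition almost_Lindelof_space :: "'a topology \<Rightarrow> bool" where
  "almost_Lindelof_space X \<longleftrightarrow>
    (\<forall>\<U>. open_cover X \<U> \<longrightarrow>
      (\<exists>\<V>. countable \<V> \<and> \<V> \<subseteq> \<U> \<and> (\<Union>V\<in>\<V>. X closure_of V) = topspace X))"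

definition weakly_Lindelof_space :: "'a topology \<Rightarrow> bool" where
  "weakly_Lindelof_space X \<longleftrightarrow>
    (\<forall>\<U>. open_cover X \<U> \<longrightarrow>
      (\<exists>\<V>. countable \<V> \<and> \<V> \<subseteq> \<U> \<and> dense_in X (\<Union>\<V>)))"

definition finite_selection :: "(nat \<Rightarrow> 'a set set) \<Rightarrow> (nat \<Rightarrow> 'a set set) \<Rightarrow> bool" where
  "finite_selection \<U> \<V> \<longleftrightarrow> (\<forall>n. finite (\<V> n) \<and> \<V> n \<subseteq> \<U> n)"

definition Menger_space :: "'a topology \<Rightarrow> bool" where
  "Menger_space X \<longleftrightarrow>
    (\<forall>\<U>. (\<forall>n. open_cover X (\<U> n)) \<longrightarrow>
      (\<exists>\<V>. finite_selection \<U> \<V> \<and> \<Union>(\<Union>n. \<V> n) = topspace X))"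

definition almost_Menger_space :: "'a topology \<Rightarrow> bool" where
  "almost_Menger_space X \<longleftrightarrow>
    (\<forall>\<U>. (\<forall>n. open_cover X (\<U> n)) \<longrightarrow>
      (\<exists>\<V>. finite_selection \<U> \<V> \<and>
        (\<Union>V\<in>(\<Union>n. \<V> n). X closure_of V) = topspace X))"

definition weakly_Menger_space :: "'a topology \<Rightarrow> bool" where
  "weakly_Menger_space X \<longleftrightarrow>
    (\<forall>\<U>. (\<forall>n. open_cover X (\<U> n)) \<longrightarrow>
      (\<exists>\<V>. finite_selection \<U> \<V> \<and> dense_in X (\<Union>(\<Union>n. \<V> n))))"

definition Scheepers_space :: "'a topology \<Rightarrow> bool" where
  "Scheepers_space X \<longleftrightarrow>
    (\<forall>\<U>. (\<forall>n. open_cover X (\<U> n)) \<longrightarrow>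
      (\<exists>\<V>. finite_selection \<U> \<V> \<and>
        (\<forall>F. finite F \<and> F \<subseteq> topspace X \<longrightarrow> (\<exists>n. F \<subseteq> \<Union>(\<V> n)))))"

definition almost_Scheepers_space :: "'a topology \<Rightarrow> bool" where
  "almost_Scheepers_space X \<longleftrightarrow>
    (\<forall>\<U>. (\<forall>n. open_cover X (\<U> n)) \<longrightarrow>
      (\<exists>\<V>. finite_selection \<U> \<V> \<and>
        (\<forall>F. finite F \<and> F \<subseteq> topspace X \<longrightarrow> (\<exists>n. F \<subseteq> X closure_of \<Union>(\<V> n)))))"

definition weakly_Scheepers_space_Sakai :: "'a topology \<Rightarrow> bool" where
  "weakly_Scheepers_space_Sakai X \<longleftrightarrow>
    (\<forall>\<U>. (\<forall>n. open_cover X (\<U> n)) \<longrightarrow>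
      (\<exists>\<V>. finite_selection \<U> \<V> \<and>
        (\<forall>\<F>. finite \<F> \<and> (\<forall>U\<in>\<F>. openin X U \<and> U \<noteq> {}) \<longrightarrow>
          (\<exists>n. \<forall>U\<in>\<F>. U \<inter> \<Union>(\<V> n) \<noteq> {}))))"

definition weakly_Scheepers_space_Kocinac :: "'a topology \<Rightarrow> bool" where
  "weakly_Scheepers_space_Kocinac X \<longleftrightarrow>
    (\<forall>\<U>. (\<forall>n. open_cover X (\<U> n)) \<longrightarrow>
      (\<exists>Y \<V>. dense_in X Y \<and> finite_selection \<U> \<V> \<and>
        (\<forall>F. finite F \<and> F \<subseteq> Y \<longrightarrow> (\<exists>n. F \<subseteq> \<Union>(\<V> n)))))"

definition G_K :: "'a topology \<Rightarrow> 'a set set set" where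
  "G_K X = {\<U>. (\<forall>U\<in>\<U>. gdelta_in X U) \<and> topspace X \<notin> \<U> \<and>
                 (\<forall>C. compactin X C \<longrightarrow> (\<exists>U\<in>\<U>. C \<subseteq> U))}"

definition almost_Alster_space :: "'a topology \<Rightarrow> bool" where
  "almost_Alster_space X \<longleftrightarrow>
    (\<forall>\<U>\<in>G_K X. \<exists>\<V>. countable \<V> \<and> \<V> \<subseteq> \<U> \<and> (\<Union>V\<in>\<V>. X closure_of V) = topspace X)"

definition weakly_Alster_space :: "'a topology \<Rightarrow> bool" where
  "weakly_Alster_space X \<longleftrightarrow>
    (\<forall>\<U>\<in>G_K X. \<exists>\<V>. countable \<V> \<and> \<V> \<subseteq> \<U> \<and> dense_in X (\<Union>\<V>))"

end

theory Submission
  imports Defs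
begin

text \<open>
  In a P-space a countable union of closed sets is closed, so the closures of countably many sets
  with dense union already cover the space. In a regular space every open cover is refined by the
  closures of an open cover. Hence a weakly Lindelof regular P-space is Lindelof, and all
  properties in question imply the weak Lindelof property in any space. Conversely, given open
  covers $U_n$ of a Lindelof P-space, choose for every point $x$ a set $U_n(x)$ in $U_n$ around it;
  the intersections over $n$ of the $U_n(x)$ form an open cover, and if $x_0, x_1, \dots$ yield a countable
  subcover, then the finite selections $U_n(x_0), \dots, U_n(x_n)$ witness the Scheepers property,
  the strongest of the selection principles. For the Alster properties, finite unions of
  the members of an open cover form a family in \<^const>\<open>G_K\<close> unless there is a finite subcover, and
  in a P-space all members of \<^const>\<open>G_K\<close> families are open.
\<close>

section \<open>Countable intersections and unions in P-spaces; density\<close>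

lemma P_space_openin_Inter:
  assumes "P_space X" "countable \<G>" "\<G> \<noteq> {}" "\<And>G. G \<in> \<G> \<Longrightarrow> openin X G"
  shows "openin X (\<Inter>\<G>)"
  using assms gdelta_in_Inter open_imp_gdelta_in unfolding P_space_def by metis

text \<open>The complement of a countable union of closed sets is a G-delta set, hence open in a
  P-space.\<close>

lemma P_space_closedin_Union:
  assumes "P_space X" "countable \<C>" "\<And>C. C \<in> \<C> \<Longrightarrow> closedin X C"
  shows "closedin X (\<Union>\<C>)"
proof -
  have "fsigma_in X (\<Union>\<C>)"
    using assms by (intro fsigma_in_Union closed_imp_fsigma_in) auto
  then show ?thesis
    using assms(1) by (auto simp: P_space_def fsigma_in_gdelta_in closedin_def)
qed

lemma open_cover_subset_topspace: "open_cover X \<U> \<Longrightarrow> U \<in> \<U> \<Longrightarrow> U \<subseteq> topspace X"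
  by (auto simp: open_cover_def)

lemma dense_inI:
  assumes "S \<subseteq> topspace X" "topspace X \<subseteq> X closure_of S"
  shows "dense_in X S"
  using assms by (simp add: dense_in_def closure_of_subset_topspace subset_antisym)

lemma dense_in_topspace: "dense_in X (topspace X)"
  by (simp add: dense_in_def)

text \<open>Each closure of a member lies in the closure of the union. This gives the step from
  "almost" to "weakly" for the Lindelof, Menger and Alster properties alike.\<close>

lemma dense_in_Union_if_closures_cover:
  assumes "(\<Union>V\<in>\<V>. X closure_of V) = topspace X" "\<And>V. V \<in> \<V> \<Longrightarrow> V \<subseteq> topspace X"
  shows "dense_in X (\<Union>\<V>)"
proof (rule dense_inI)
  have "X closure_of V \<subseteq> X closure_of \<Union>\<V>" if "V \<in> \<V>" for V
    using that by (intro closure_of_mono) auto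
  then show "topspace X \<subseteq> X closure_of \<Union>\<V>"
    using assms(1) by blast
qed (use assms(2) in blast)

lemma closures_cover_if_cover:
  assumes "\<Union>\<V> = topspace X"
  shows "(\<Union>V\<in>\<V>. X closure_of V) = topspace X"
proof
  show "(\<Union>V\<in>\<V>. X closure_of V) \<subseteq> topspace X"
    by (intro UN_least closure_of_subset_topspace)
  have "V \<subseteq> X closure_of V" if "V \<in> \<V>" for V
    using that assms by (intro closure_of_subset) auto
  then have "(\<Union>V\<in>\<V>. V) \<subseteq> (\<Union>V\<in>\<V>. X closure_of V)"
    by (intro UN_mono) auto
  then show "topspace X \<subseteq> (\<Union>V\<in>\<V>. X closure_of V)"
    using assms by simp
qed

lemma dense_in_iff_meets_open:
  "dense_in X S \<longleftrightarrow> S \<subseteq> topspace X \<and> (\<forall>U. openin X U \<and> U \<noteq> {} \<longrightarrow> U \<inter> S \<noteq> {})"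
  using dense_intersects_open[of X S] by (auto simp: dense_in_def)

section \<open>From weakly Lindelof to Lindelof to Scheepers\<close>

lemma weakly_Lindelof_imp_Lindelof_space:
  assumes "regular_space X" "P_space X" "weakly_Lindelof_space X"
  shows "Lindelof_space X"
  unfolding Lindelof_space_def
proof (intro allI impI)
  fix \<U> assume \<U>: "(\<forall>U\<in>\<U>. openin X U) \<and> \<Union>\<U> = topspace X"
  define \<W> where "\<W> = {W. openin X W \<and> (\<exists>U\<in>\<U>. X closure_of W \<subseteq> U)}"
  have "\<exists>W\<in>\<W>. x \<in> W" if x: "x \<in> topspace X" for x
  proof -
    obtain U where U: "U \<in> \<U>" "x \<in> U" using \<U> x by auto
    \<comment> \<open>Regularity says that closed neighbourhoods form a base. The closed set
      \<open>C\<close> between \<open>W\<close> and \<open>U\<close> contains the closure of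
      \<open>W\<close>, so \<open>W\<close> belongs to \<open>\<W>\<close>.\<close>
    then obtain W C where "openin X W" "closedin X C" "x \<in> W" "W \<subseteq> C" "C \<subseteq> U"
      using assms(1) \<U> unfolding neighbourhood_base_of_closedin[symmetric] neighbourhood_base_of
      by metis
    then show ?thesis
      using U closure_of_minimal[of W C X] unfolding \<W>_def by blast
  qed
  moreover have "W \<subseteq> topspace X" if "W \<in> \<W>" for W
    using that by (auto simp: \<W>_def dest: openin_subset)
  ultimately have "open_cover X \<W>"
    unfolding open_cover_def by (auto simp: \<W>_def)
  then obtain \<V> where \<V>: "countable \<V>" "\<V> \<subseteq> \<W>" "dense_in X (\<Union>\<V>)"
    using assms(3)[unfolded weakly_Lindelof_space_def, THEN spec, of \<W>] by blast
  \<comment> \<open>The P-space property enters here: being closed and containing the dense set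
    \<open>\<Union>\<V>\<close>, this countable union of closures is the whole space.\<close>
  have "closedin X (\<Union>V\<in>\<V>. X closure_of V)"
    using assms(2) \<V>(1) by (intro P_space_closedin_Union) auto
  moreover have "\<Union>\<V> \<subseteq> (\<Union>V\<in>\<V>. X closure_of V)"
    using \<V>(2) by (intro Union_least) (force simp: \<W>_def dest: closure_of_subset openin_subset)
  ultimately have cover: "topspace X \<subseteq> (\<Union>V\<in>\<V>. X closure_of V)"
    using \<V>(3) closure_of_minimal unfolding dense_in_def by metis
  from \<V>(2) obtain f where f: "\<And>V. V \<in> \<V> \<Longrightarrow> f V \<in> \<U> \<and> X closure_of V \<subseteq> f V"
    unfolding \<W>_def by (auto simp: subset_eq) metis
  show "\<exists>\<V>. countable \<V> \<and> \<V> \<subseteq> \<U> \<and> \<Union>\<V> = topspace X"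
  proof (intro exI conjI)
    show "countable (f ` \<V>)" using \<V>(1) by simp
    show "f ` \<V> \<subseteq> \<U>" using f by auto
    have "\<Union>(f ` \<V>) \<subseteq> topspace X" using f \<U> by blast
    moreover have "(\<Union>V\<in>\<V>. X closure_of V) \<subseteq> \<Union>(f ` \<V>)" using f by (intro UN_mono) auto
    ultimately show "\<Union>(f ` \<V>) = topspace X" using cover by simp
  qed
qed

lemma Lindelof_P_imp_Scheepers_space:
  assumes "P_space X" "Lindelof_space X"
  shows "Scheepers_space X"
  unfolding Scheepers_space_def
proof (intro allI impI)
  fix \<U> :: "nat \<Rightarrow> 'a set set" assume \<U>: "\<forall>n. open_cover X (\<U> n)"
  have "\<forall>n x. \<exists>U. x \<in> topspace X \<longrightarrow> U \<in> \<U> n \<and> x \<in> U"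
    using \<U> unfolding open_cover_def by blast
  then obtain u where u: "\<And>n x. x \<in> topspace X \<Longrightarrow> u n x \<in> \<U> n \<and> x \<in> u n x"
    by metis
  \<comment> \<open>The choice of \<open>u\<close> is fixed once for all covers, so that one
    countable set of points serves every \<open>n\<close> simultaneously. Each \<open>G x\<close> is
    a countable intersection of open sets, hence open in a P-space.\<close>
  define G where "G x = (\<Inter>n. u n x)" for x
  have "openin X (G x)" if "x \<in> topspace X" for x
    unfolding G_def
    using assms(1) u[OF that] \<U> by (intro P_space_openin_Inter) (auto simp: open_cover_def)
  moreover have "x \<in> G x" if "x \<in> topspace X" for x
    using u[OF that] by (simp add: G_def)
  ultimately have "(\<forall>U\<in>G ` topspace X. openin X U) \<and> \<Union>(G ` topspace X) = topspace X"
    by (auto dest: openin_subset)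
  then obtain \<C> where "countable \<C>" "\<C> \<subseteq> G ` topspace X" "\<Union>\<C> = topspace X"
    using assms(2) unfolding Lindelof_space_def by meson
  then obtain D where D: "countable D" "D \<subseteq> topspace X" "\<Union>(G ` D) = topspace X"
    using countable_subset_image[of \<C> G "topspace X"] by auto
  show "\<exists>\<V>. finite_selection \<U> \<V> \<and>
          (\<forall>F. finite F \<and> F \<subseteq> topspace X \<longrightarrow> (\<exists>n. F \<subseteq> \<Union>(\<V> n)))"
  \<comment> \<open>Only a nonempty \<open>D\<close> can be enumerated by
    \<open>from_nat_into\<close>. If \<open>D\<close> is empty, so is the space, and empty
    selections suffice.\<close>
  proof (cases "D = {}")
    case True
    then have "topspace X = {}" using D(3) by auto
    then show ?thesis
      by (intro exI[of _ "\<lambda>_. {}"]) (simp add: finite_selection_def)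
  next
    case False
    define p where "p = from_nat_into D"
    have p: "range p = D"
      using D(1) False by (simp add: p_def range_from_nat_into)
    \<comment> \<open>A point of \<open>G (p i)\<close> lies in \<open>u n (p i)\<close> for every
      \<open>n\<close>, hence in \<open>\<Union>(\<V> n)\<close> as soon as
      \<open>i \<le> n\<close>. A finite set is therefore caught by any \<open>n\<close> that bounds
      the indices of its points.\<close>
    define \<V> where "\<V> n = (\<lambda>i. u n (p i)) ` {..n}" for n
    have "finite_selection \<U> \<V>"
      using u p D(2) by (force simp: finite_selection_def \<V>_def)
    moreover have "\<exists>n. F \<subseteq> \<Union>(\<V> n)" if F: "finite F" "F \<subseteq> topspace X" for F
    proof -
      have "\<forall>x\<in>F. \<exists>i. x \<in> G (p i)"
        using F(2) D(3) p by blast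
      then obtain k where k: "\<And>x. x \<in> F \<Longrightarrow> x \<in> G (p (k x))" by metis
      obtain n where "\<And>x. x \<in> F \<Longrightarrow> k x \<le> n"
        using finite_imageI[OF F(1), of k] finite_nat_set_iff_bounded_le by auto
      then have "F \<subseteq> \<Union>(\<V> n)"
        using k by (fastforce simp: \<V>_def G_def)
      then show ?thesis ..
    qed
    ultimately show ?thesis by blast
  qed
qed

section \<open>Implications among the Menger and Scheepers properties\<close>

lemma Scheepers_imp_Menger_space:
  assumes "Scheepers_space X" shows "Menger_space X"
  unfolding Menger_space_def
proof (intro allI impI)
  fix \<U> :: "nat \<Rightarrow> 'a set set" assume \<U>: "\<forall>n. open_cover X (\<U> n)"
  then obtain \<V> where \<V>: "finite_selection \<U> \<V>"
      "\<And>F. finite F \<and> F \<subseteq> topspace X \<Longrightarrow> \<exists>n. F \<subseteq> \<Union>(\<V> n)"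
    using assms[unfolded Scheepers_space_def, THEN spec, of \<U>] by blast
  have "x \<in> \<Union>(\<Union>n. \<V> n)" if "x \<in> topspace X" for x
    using \<V>(2)[of "{x}"] that by auto
  moreover have "\<Union>(\<Union>n. \<V> n) \<subseteq> topspace X"
    using \<V>(1) \<U> open_cover_subset_topspace unfolding finite_selection_def by blast
  ultimately show "\<exists>\<V>. finite_selection \<U> \<V> \<and> \<Union>(\<Union>n. \<V> n) = topspace X"
    using \<V>(1) by blast
qed

lemma Menger_imp_almost_Menger_space:
  assumes "Menger_space X" shows "almost_Menger_space X"
  unfolding almost_Menger_space_def
proof (intro allI impI)
  fix \<U> :: "nat \<Rightarrow> 'a set set" assume \<U>: "\<forall>n. open_cover X (\<U> n)"
  then obtain \<V> where \<V>: "finite_selection \<U> \<V>" "\<Union>(\<Union>n. \<V> n) = topspace X"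
    using assms[unfolded Menger_space_def, THEN spec, of \<U>] by blast
  then show "\<exists>\<V>. finite_selection \<U> \<V> \<and> (\<Union>V\<in>(\<Union>n. \<V> n). X closure_of V) = topspace X"
    using closures_cover_if_cover by (intro exI[of _ \<V>] conjI)
qed

lemma almost_Menger_imp_weakly_Menger_space:
  assumes "almost_Menger_space X" shows "weakly_Menger_space X"
  unfolding weakly_Menger_space_def
proof (intro allI impI)
  fix \<U> :: "nat \<Rightarrow> 'a set set" assume \<U>: "\<forall>n. open_cover X (\<U> n)"
  then obtain \<V> where \<V>: "finite_selection \<U> \<V>"
      "(\<Union>V\<in>(\<Union>n. \<V> n). X closure_of V) = topspace X"
    using assms[unfolded almost_Menger_space_def, THEN spec, of \<U>] by blast
  moreover have "V \<subseteq> topspace X" if "V \<in> (\<Union>n. \<V> n)" for V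
    using that \<V>(1) \<U> open_cover_subset_topspace unfolding finite_selection_def by blast
  ultimately show "\<exists>\<V>. finite_selection \<U> \<V> \<and> dense_in X (\<Union>(\<Union>n. \<V> n))"
    by (intro exI[of _ \<V>] conjI dense_in_Union_if_closures_cover; simp)
qed

lemma weakly_Menger_imp_weakly_Lindelof_space:
  assumes "weakly_Menger_space X" shows "weakly_Lindelof_space X"
  unfolding weakly_Lindelof_space_def
proof (intro allI impI)
  fix \<U> assume "open_cover X \<U>"
  \<comment> \<open>The selection principle is applied to a constant sequence of covers; countably
    many finite selections make up one countable subfamily.\<close>
  then obtain \<V> where \<V>: "finite_selection (\<lambda>_. \<U>) \<V>" "dense_in X (\<Union>(\<Union>n. \<V> n))"
    using assms[unfolded weakly_Menger_space_def, rule_format, of "\<lambda>_. \<U>"] by blast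
  then have "countable (\<Union>n. \<V> n)" "(\<Union>n. \<V> n) \<subseteq> \<U>"
    unfolding finite_selection_def by (auto intro: countable_finite)
  then show "\<exists>\<V>. countable \<V> \<and> \<V> \<subseteq> \<U> \<and> dense_in X (\<Union>\<V>)"
    using \<V>(2) by blast
qed

lemma Scheepers_imp_almost_Scheepers_space:
  assumes "Scheepers_space X" shows "almost_Scheepers_space X"
  unfolding almost_Scheepers_space_def
proof (intro allI impI)
  fix \<U> :: "nat \<Rightarrow> 'a set set" assume \<U>: "\<forall>n. open_cover X (\<U> n)"
  then obtain \<V> where \<V>: "finite_selection \<U> \<V>"
      "\<And>F. finite F \<and> F \<subseteq> topspace X \<Longrightarrow> \<exists>n. F \<subseteq> \<Union>(\<V> n)"
    using assms[unfolded Scheepers_space_def, THEN spec, of \<U>] by blast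
  have "\<Union>(\<V> n) \<subseteq> X closure_of \<Union>(\<V> n)" for n
    using \<V>(1) \<U> open_cover_subset_topspace unfolding finite_selection_def
    by (intro closure_of_subset) blast
  then show "\<exists>\<V>. finite_selection \<U> \<V> \<and>
      (\<forall>F. finite F \<and> F \<subseteq> topspace X \<longrightarrow> (\<exists>n. F \<subseteq> X closure_of \<Union>(\<V> n)))"
    using \<V> by (meson order_trans)
qed

lemma almost_Scheepers_imp_almost_Menger_space:
  assumes "almost_Scheepers_space X" shows "almost_Menger_space X"
  unfolding almost_Menger_space_def
proof (intro allI impI)
  fix \<U> :: "nat \<Rightarrow> 'a set set" assume \<U>: "\<forall>n. open_cover X (\<U> n)"
  then obtain \<V> where \<V>: "finite_selection \<U> \<V>"
      "\<And>F. finite F \<and> F \<subseteq> topspace X \<Longrightarrow> \<exists>n. F \<subseteq> X closure_of \<Union>(\<V> n)"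
    using assms[unfolded almost_Scheepers_space_def, THEN spec, of \<U>] by blast
  have "x \<in> (\<Union>V\<in>(\<Union>n. \<V> n). X closure_of V)" if x: "x \<in> topspace X" for x
  proof -
    obtain n where "x \<in> X closure_of \<Union>(\<V> n)"
      using \<V>(2)[of "{x}"] x by auto
    moreover have "finite (\<V> n)" using \<V>(1) by (simp add: finite_selection_def)
    \<comment> \<open>Closure commutes with finite unions, so the point lies in the closure of a
      single member of \<open>\<V> n\<close>.\<close>
    ultimately show ?thesis by (auto simp: closure_of_Union)
  qed
  moreover have "(\<Union>V\<in>(\<Union>n. \<V> n). X closure_of V) \<subseteq> topspace X"
    by (intro UN_least closure_of_subset_topspace)
  ultimately have "(\<Union>V\<in>(\<Union>n. \<V> n). X closure_of V) = topspace X"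
    by blast
  then show "\<exists>\<V>. finite_selection \<U> \<V> \<and> (\<Union>V\<in>(\<Union>n. \<V> n). X closure_of V) = topspace X"
    using \<V>(1) by blast
qed

lemma Scheepers_imp_weakly_Scheepers_space_Kocinac:
  assumes "Scheepers_space X" shows "weakly_Scheepers_space_Kocinac X"
  unfolding weakly_Scheepers_space_Kocinac_def
proof (intro allI impI)
  fix \<U> :: "nat \<Rightarrow> 'a set set" assume "\<forall>n. open_cover X (\<U> n)"
  with assms have "\<exists>\<V>. finite_selection \<U> \<V> \<and>
      (\<forall>F. finite F \<and> F \<subseteq> topspace X \<longrightarrow> (\<exists>n. F \<subseteq> \<Union>(\<V> n)))"
    by (simp add: Scheepers_space_def)
  then show "\<exists>Y \<V>. dense_in X Y \<and> finite_selection \<U> \<V> \<and>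
      (\<forall>F. finite F \<and> F \<subseteq> Y \<longrightarrow> (\<exists>n. F \<subseteq> \<Union>(\<V> n)))"
    by (intro exI[of _ "topspace X"]) (simp add: dense_in_topspace)
qed

text \<open>A dense set \<open>Y\<close> meets every nonempty open set. Picking one point of
  \<open>Y\<close> in each member of a finite family turns the family into a finite subset of
  \<open>Y\<close>, and the selection containing these points meets every member.\<close>

lemma weakly_Scheepers_Kocinac_imp_Sakai:
  assumes "weakly_Scheepers_space_Kocinac X" shows "weakly_Scheepers_space_Sakai X"
  unfolding weakly_Scheepers_space_Sakai_def
proof (intro allI impI)
  fix \<U> :: "nat \<Rightarrow> 'a set set" assume "\<forall>n. open_cover X (\<U> n)"
  then obtain Y \<V> where Y: "dense_in X Y" and \<V>: "finite_selection \<U> \<V>"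
      "\<And>F. finite F \<and> F \<subseteq> Y \<Longrightarrow> \<exists>n. F \<subseteq> \<Union>(\<V> n)"
    using assms[unfolded weakly_Scheepers_space_Kocinac_def, THEN spec, of \<U>] by blast
  have "\<exists>n. \<forall>U\<in>\<F>. U \<inter> \<Union>(\<V> n) \<noteq> {}"
    if \<F>: "finite \<F>" "\<forall>U\<in>\<F>. openin X U \<and> U \<noteq> {}" for \<F>
  proof -
    have "\<forall>U\<in>\<F>. \<exists>x. x \<in> U \<inter> Y"
      using Y \<F>(2) unfolding dense_in_iff_meets_open by blast
    then obtain y where y: "\<And>U. U \<in> \<F> \<Longrightarrow> y U \<in> U \<inter> Y" by metis
    then have "y ` \<F> \<subseteq> Y" by blast
    then obtain n where "y ` \<F> \<subseteq> \<Union>(\<V> n)"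
      using \<V>(2)[of "y ` \<F>"] \<F>(1) by blast
    with y show ?thesis by blast
  qed
  then show "\<exists>\<V>. finite_selection \<U> \<V> \<and>
      (\<forall>\<F>. finite \<F> \<and> (\<forall>U\<in>\<F>. openin X U \<and> U \<noteq> {}) \<longrightarrow>
        (\<exists>n. \<forall>U\<in>\<F>. U \<inter> \<Union>(\<V> n) \<noteq> {}))"
    using \<V>(1) by (intro exI[of _ \<V>] conjI) simp_all
qed

lemma weakly_Scheepers_Sakai_imp_weakly_Menger_space:
  assumes "weakly_Scheepers_space_Sakai X" shows "weakly_Menger_space X"
  unfolding weakly_Menger_space_def
proof (intro allI impI)
  fix \<U> :: "nat \<Rightarrow> 'a set set" assume \<U>: "\<forall>n. open_cover X (\<U> n)"
  then obtain \<V> where \<V>: "finite_selection \<U> \<V>"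
      "\<And>\<F>. finite \<F> \<and> (\<forall>U\<in>\<F>. openin X U \<and> U \<noteq> {}) \<Longrightarrow> \<exists>n. \<forall>U\<in>\<F>. U \<inter> \<Union>(\<V> n) \<noteq> {}"
    using assms[unfolded weakly_Scheepers_space_Sakai_def, THEN spec, of \<U>] by blast
  \<comment> \<open>One-element families are enough to see that the union of all selections meets
    every nonempty open set.\<close>
  have "U \<inter> \<Union>(\<Union>n. \<V> n) \<noteq> {}" if "openin X U" "U \<noteq> {}" for U
    using \<V>(2)[of "{U}"] that by auto
  moreover have "\<Union>(\<Union>n. \<V> n) \<subseteq> topspace X"
    using \<V>(1) \<U> open_cover_subset_topspace unfolding finite_selection_def by blast
  ultimately have "dense_in X (\<Union>(\<Union>n. \<V> n))"
    unfolding dense_in_iff_meets_open by blast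
  then show "\<exists>\<V>. finite_selection \<U> \<V> \<and> dense_in X (\<Union>(\<Union>n. \<V> n))"
    using \<V>(1) by blast
qed

section \<open>Implications among the Lindelof properties\<close>

lemma Lindelof_imp_almost_Lindelof_space:
  assumes "Lindelof_space X" shows "almost_Lindelof_space X"
  unfolding almost_Lindelof_space_def
proof (intro allI impI)
  fix \<U> assume "open_cover X \<U>"
  then obtain \<V> where \<V>: "countable \<V>" "\<V> \<subseteq> \<U>" "\<Union>\<V> = topspace X"
    using assms[unfolded Lindelof_space_def, THEN spec, of \<U>] by (auto simp: open_cover_def)
  then show "\<exists>\<V>. countable \<V> \<and> \<V> \<subseteq> \<U> \<and> (\<Union>V\<in>\<V>. X closure_of V) = topspace X"
    using closures_cover_if_cover by (intro exI[of _ \<V>] conjI)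
qed

lemma almost_Lindelof_imp_weakly_Lindelof_space:
  assumes "almost_Lindelof_space X" shows "weakly_Lindelof_space X"
  unfolding weakly_Lindelof_space_def
proof (intro allI impI)
  fix \<U> assume \<U>: "open_cover X \<U>"
  then obtain \<V> where \<V>: "countable \<V>" "\<V> \<subseteq> \<U>" "(\<Union>V\<in>\<V>. X closure_of V) = topspace X"
    using assms[unfolded almost_Lindelof_space_def, THEN spec, of \<U>] by blast
  moreover have "V \<subseteq> topspace X" if "V \<in> \<V>" for V
    using that \<V>(2) \<U> open_cover_subset_topspace by blast
  ultimately show "\<exists>\<V>. countable \<V> \<and> \<V> \<subseteq> \<U> \<and> dense_in X (\<Union>\<V>)"
    by (intro exI[of _ \<V>] conjI dense_in_Union_if_closures_cover; simp)
qed

section \<open>Alster properties\<close>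

lemma P_space_almost_Lindelof_imp_almost_Alster_space:
  assumes "P_space X" "almost_Lindelof_space X"
  shows "almost_Alster_space X"
  unfolding almost_Alster_space_def
proof
  fix \<U> assume \<U>: "\<U> \<in> G_K X"
  then have op: "\<forall>U\<in>\<U>. openin X U"
    using assms(1) by (auto simp: G_K_def P_space_def)
  \<comment> \<open>Singletons are compact, so a family in \<open>G_K X\<close> covers the
    space.\<close>
  have "x \<in> \<Union>\<U>" if "x \<in> topspace X" for x
  proof -
    have "compactin X {x}" using that by simp
    then show ?thesis using \<U> unfolding G_K_def by blast
  qed
  then have "open_cover X \<U>"
    using op by (auto simp: open_cover_def dest: openin_subset)
  then show "\<exists>\<V>. countable \<V> \<and> \<V> \<subseteq> \<U> \<and> (\<Union>V\<in>\<V>. X closure_of V) = topspace X"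
    using assms(2)[unfolded almost_Lindelof_space_def, THEN spec, of \<U>] by blast
qed

lemma almost_Alster_imp_weakly_Alster_space:
  assumes "almost_Alster_space X" shows "weakly_Alster_space X"
  unfolding weakly_Alster_space_def
proof
  fix \<U> assume \<U>: "\<U> \<in> G_K X"
  obtain \<V> where \<V>: "countable \<V>" "\<V> \<subseteq> \<U>" "(\<Union>V\<in>\<V>. X closure_of V) = topspace X"
    using assms[unfolded almost_Alster_space_def, THEN bspec, OF \<U>] by blast
  moreover have "V \<subseteq> topspace X" if "V \<in> \<V>" for V
    using that \<V>(2) \<U> gdelta_in_subset unfolding G_K_def by blast
  ultimately show "\<exists>\<V>. countable \<V> \<and> \<V> \<subseteq> \<U> \<and> dense_in X (\<Union>\<V>)"
    by (intro exI[of _ \<V>] conjI dense_in_Union_if_closures_cover; simp)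
qed

text \<open>Closing an open cover under finite unions makes every compact set fit into one member,
  as \<open>G_K\<close> demands. Afterwards each selected finite union is split again into its
  finitely many pieces.\<close>

lemma weakly_Alster_imp_weakly_Lindelof_space:
  assumes "weakly_Alster_space X" shows "weakly_Lindelof_space X"
  unfolding weakly_Lindelof_space_def
proof (intro allI impI)
  fix \<U> assume \<U>: "open_cover X \<U>"
  define \<W> where "\<W> = {\<Union>\<F> |\<F>. finite \<F> \<and> \<F> \<subseteq> \<U>}"
  have op: "openin X W" if "W \<in> \<W>" for W
    using that \<U> by (auto simp: \<W>_def open_cover_def intro!: openin_Union)
  have "\<exists>\<C>. countable \<C> \<and> \<C> \<subseteq> \<W> \<and> dense_in X (\<Union>\<C>)"
  \<comment> \<open>Families in \<open>G_K X\<close> must not contain the whole space. If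
    \<open>\<W>\<close> contains it, that single member is already dense.\<close>
  proof (cases "topspace X \<in> \<W>")
    case True
    then show ?thesis
      using dense_in_topspace by (intro exI[of _ "{topspace X}"]) simp
  next
    case False
    have "\<exists>W\<in>\<W>. C \<subseteq> W" if C: "compactin X C" for C
    proof -
      obtain \<F> where "finite \<F>" "\<F> \<subseteq> \<U>" "C \<subseteq> \<Union>\<F>"
        using C \<U> unfolding compactin_def open_cover_def by metis
      then show ?thesis unfolding \<W>_def by blast
    qed
    with False op have "\<W> \<in> G_K X"
      by (auto simp: G_K_def open_imp_gdelta_in)
    then show ?thesis
      by (rule assms[unfolded weakly_Alster_space_def, THEN bspec])
  qed
  then obtain \<C> where \<C>: "countable \<C>" "\<C> \<subseteq> \<W>" "dense_in X (\<Union>\<C>)" by blast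
  have "\<forall>W\<in>\<C>. \<exists>\<F>. finite \<F> \<and> \<F> \<subseteq> \<U> \<and> \<Union>\<F> = W"
    using \<C>(2) unfolding \<W>_def by blast
  then obtain f where f: "\<And>W. W \<in> \<C> \<Longrightarrow> finite (f W) \<and> f W \<subseteq> \<U> \<and> \<Union>(f W) = W"
    by metis
  show "\<exists>\<V>. countable \<V> \<and> \<V> \<subseteq> \<U> \<and> dense_in X (\<Union>\<V>)"
  proof (intro exI conjI)
    show "countable (\<Union>(f ` \<C>))"
      using \<C>(1) f by (auto intro: countable_finite)
    show "\<Union>(f ` \<C>) \<subseteq> \<U>" using f by blast
    \<comment> \<open>Replacing each \<open>W\<close> by its pieces leaves the union unchanged, so
      density carries over.\<close>
    have "\<Union>(\<Union>(f ` \<C>)) = (\<Union>W\<in>\<C>. \<Union>(f W))" by blast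
    also have "\<dots> = \<Union>\<C>" using f by simp
    finally have "\<Union>(\<Union>(f ` \<C>)) = \<Union>\<C>" .
    then show "dense_in X (\<Union>(\<Union>(f ` \<C>)))" using \<C>(3) by simp
  qed
qed

theorem corollary3p3:
  fixes X :: "'a topology"
  assumes "regular_space X" and "P_space X"
  shows "(Lindelof_space X \<longleftrightarrow> Menger_space X)
       \<and> (Lindelof_space X \<longleftrightarrow> Scheepers_space X)
       \<and> (Lindelof_space X \<longleftrightarrow> almost_Lindelof_space X)
       \<and> (Lindelof_space X \<longleftrightarrow> almost_Menger_space X)
       \<and> (Lindelof_space X \<longleftrightarrow> almost_Scheepers_space X)
       \<and> (Lindelof_space X \<longleftrightarrow> almost_Alster_space X)
       \<and> (Lindelof_space X \<longleftrightarrow> weakly_Lindelof_space X)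
       \<and> (Lindelof_space X \<longleftrightarrow> weakly_Menger_space X)
       \<and> (Lindelof_space X \<longleftrightarrow> weakly_Scheepers_space_Sakai X)
       \<and> (Lindelof_space X \<longleftrightarrow> weakly_Alster_space X)
       \<and> (Lindelof_space X \<longleftrightarrow> weakly_Scheepers_space_Kocinac X)"
  \<comment> \<open>The implications form cycles through \<open>Lindelof_space X\<close>: the
    selection principles lie between the Scheepers and the weakly Menger property, the Alster
    properties between almost Lindelof and weakly Lindelof. Both routes end in the weak Lindelof
    property, from which regularity and the P-space property lead back.\<close>
  using weakly_Lindelof_imp_Lindelof_space[OF assms]
    Lindelof_P_imp_Scheepers_space[OF assms(2)]
    Scheepers_imp_Menger_space[of X] Menger_imp_almost_Menger_space[of X]
    almost_Menger_imp_weakly_Menger_space[of X] weakly_Menger_imp_weakly_Lindelof_space[of X]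
    Scheepers_imp_almost_Scheepers_space[of X] almost_Scheepers_imp_almost_Menger_space[of X]
    Scheepers_imp_weakly_Scheepers_space_Kocinac[of X] weakly_Scheepers_Kocinac_imp_Sakai[of X]
    weakly_Scheepers_Sakai_imp_weakly_Menger_space[of X]
    Lindelof_imp_almost_Lindelof_space[of X] almost_Lindelof_imp_weakly_Lindelof_space[of X]
    P_space_almost_Lindelof_imp_almost_Alster_space[OF assms(2)]
    almost_Alster_imp_weakly_Alster_space[of X] weakly_Alster_imp_weakly_Lindelof_space[of X]
  by (intro conjI iffI; metis)

end
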